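(* Let $G=\sum_{j=0}^{\infty}\frac{(-1)^j}{(2j+1)^2}$ be Catalan's constant. For every integer $m\ge0$, $$\sum_{n=0}^{\infty}\frac{1}{16^n}\binom{2n}{n}^{2}\frac{1}{2n+m+1}=\frac{2}{\pi}\int_0^1x^mK(x)\,dx=\frac1\pi\begin{cases}\displaystyle\frac{2\cdot16^\ell}{(2\ell+1)^2\binom{2\ell}{\ell}^2}\sum_{j=0}^{\ell}\frac{\binom{2j}{j}^2}{16^j},&m=2\ell+1,\\[12pt]\displaystyle\frac{\binom{2\ell}{\ell}^2}{16^\ell}\left(4G+\frac12\sum_{j=1}^{\ell}\frac{16^j}{j^2\binom{2j}{j}^2}\right),&m=2\ell,\end{cases}$$ where $\ell$ denotes a non-negative integer.
   Context: $K(k)=\int_0^{\pi/2}\frac{d\theta}{\sqrt{1-k^2\sin^2\theta}}$ is the complete elliptic integral of the first kind in the modulus convention. *)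

theory Defs
  imports "HOL-Analysis.Analysis"
begin

(* Modulus convention: the argument k enters the integrand as k^2. The defining integral
   converges for |k| < 1; at k = 1 it diverges and ellipticK takes the default value of
   the gauge integral, which is a single point and does not affect integrals over [0,1]. *)
definition ellipticK :: "real \<Rightarrow> real" where
  "ellipticK k = integral {0..pi/2} (\<lambda>\<theta>. 1 / sqrt (1 - k\<^sup>2 * (sin \<theta>)\<^sup>2))"

definition catalan_G :: real where
  "catalan_G = (\<Sum>j. (-1) ^ j / (2 * real j + 1)\<^sup>2)"

end

theory Submission
  imports Defs "HOL-Real_Asymp.Real_Asymp"
begin

text \<open>
  Write \<open>a\<^sub>n\<close> for the square of the central binomial ratio (\<open>2n\<close> choose \<open>n\<close>) / \<open>4\<^sup>n\<close>, and
  \<open>S(s)\<close> for the sum of \<open>a\<^sub>n / (2n + s)\<close> over all \<open>n\<close>. Expanding the integrand of \<open>K\<close> by the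
  binomial series and integrating termwise shows that \<open>K(x)\<close> is \<open>\<pi>/2\<close> times the sum of
  \<open>a\<^sub>n x\<^sup>2\<^sup>n\<close>. All terms are nonnegative, so monotone convergence permits a second termwise
  integration and identifies \<open>2/\<pi>\<close> times the \<open>m\<close>-th moment of \<open>K\<close> with \<open>S(m + 1)\<close>
  (\<open>has_integral_ellipticK_moment\<close>).

  The closed forms come from the recurrence \<open>(s + 1)\<^sup>2 S(s + 2) = s\<^sup>2 S(s) + 2/\<pi>\<close>
  (\<open>cbinsum_recurrence\<close>). It expresses that the partial sums of \<open>(s + 1)\<^sup>2 S(s + 2) - s\<^sup>2 S(s)\<close>
  telescope to \<open>(2N)\<^sup>2 a\<^sub>N / (2N + s)\<close>, a consequence of \<open>(2n + 2)\<^sup>2 a\<^sub>n\<^sub>+\<^sub>1 = (2n + 1)\<^sup>2 a\<^sub>n\<close>; and this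
  tends to \<open>2/\<pi>\<close> because \<open>2N a\<^sub>N\<close> does, by the Wallis product. The telescoping at \<open>s = 0\<close> gives
  \<open>S(2) = 2/\<pi>\<close>, from which all odd \<open>m\<close> follow by induction.

  For even \<open>m\<close> the induction starts at \<open>S(1) = 4G/\<pi>\<close> (\<open>cbinsum_1\<close>), which is obtained by
  integrating \<open>\<theta> / sin \<theta>\<close> over \<open>[0, \<pi>/2]\<close> in two ways. The arcsine series at \<open>sin \<theta>\<close> together
  with the Wallis integrals gives \<open>\<pi>/2 S(1)\<close>. The half-angle substitution \<open>t = tan (\<theta>/2)\<close> gives
  twice the integral of \<open>arctan t / t\<close> over \<open>[0, 1]\<close>, which is \<open>2 G\<close>.
\<close>

section \<open>Central binomial ratios\<close>

text \<open>The number \<open>cbin n\<close> is the Wallis ratio \<open>(2n-1)!! / (2n)!!\<close>. It enters the proof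
  three times: as Taylor coefficient of \<open>(1 - u)\<close> to the power \<open>-1/2\<close>, as the mean value of
  \<open>sin\<^sup>2\<^sup>n\<close> over a quarter period, and, squared, as the coefficient in the series of the
  theorem.\<close>
definition cbin :: "nat \<Rightarrow> real" where
  "cbin n = real ((2 * n) choose n) / 4 ^ n"

lemma cbin_0 [simp]: "cbin 0 = 1"
  by (simp add: cbin_def)

lemma cbin_Suc: "cbin (Suc n) = cbin n * ((2 * real n + 1) / (2 * real n + 2))"
proof -
  have "real ((2 * n) choose n) = fact (2 * n) / (fact n * fact n)"
    by (simp add: binomial_fact)
  moreover have "real ((2 * Suc n) choose Suc n)
      = fact (Suc (Suc (2 * n))) / (fact (Suc n) * fact (Suc n))"
    by (subst binomial_fact) simp_all
  ultimately have "cbin n = fact (2 * n) / (fact n * fact n) / 4 ^ n"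
    and "cbin (Suc n) = fact (Suc (Suc (2 * n))) / (fact (Suc n) * fact (Suc n)) / 4 ^ Suc n"
    unfolding cbin_def by (simp_all only:)
  thus ?thesis
    by (simp only:) (simp add: divide_simps, simp add: algebra_simps)
qed

lemma cbin_pos: "0 < cbin n"
  by (simp add: cbin_def)

lemma cbin_nonneg: "0 \<le> cbin n"
  using cbin_pos[of n] by simp

lemma cbin_square: "(cbin n)\<^sup>2 = (real ((2 * n) choose n))\<^sup>2 / 16 ^ n"
  by (simp add: cbin_def power_divide flip: power_mult power_mult_distrib)
     (simp add: power_mult power2_eq_square mult.commute[of _ 2])

text \<open>The quotient of consecutive terms, with denominators cleared; the recurrence of the moments
  and both closed forms rest on this identity.\<close>
lemma cbin_square_Suc:
  "(2 * real n + 2)\<^sup>2 * (cbin (Suc n))\<^sup>2 = (2 * real n + 1)\<^sup>2 * (cbin n)\<^sup>2"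
  by (simp add: cbin_Suc power_mult_distrib power_divide)

lemma cbin_eq_gbinomial: "cbin n = (- 1) ^ n * ((- 1 / 2) gchoose n)"
proof (induction n)
  case (Suc n)
  have "real (Suc n) * ((- 1 / 2) gchoose Suc n) = (- 1 / 2 - real n) * ((- 1 / 2) gchoose n)"
    using gbinomial_mult_1[of "- 1 / 2 :: real" n] by (simp add: algebra_simps)
  hence *: "((- 1 / 2 :: real) gchoose Suc n) = (- 1 / 2 - real n) * ((- 1 / 2) gchoose n) / real (Suc n)"
    by (simp only: mult.commute nonzero_eq_divide_eq of_nat_neq_0 not_False_eq_True)
  show ?case
    unfolding * cbin_Suc Suc by (simp add: divide_simps) (simp add: algebra_simps)
qed simp

lemma cbin_power_series:
  assumes "\<bar>u\<bar> < 1"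
  shows "(\<lambda>n. cbin n * u ^ n) sums (1 / sqrt (1 - u))"
proof -
  have "(\<lambda>n. ((- 1 / 2) gchoose n) * (- u) ^ n) sums (1 + (- u)) powr (- 1 / 2)"
    using assms by (intro gen_binomial_real) simp
  moreover have "(1 + (- u)) powr (- 1 / 2) = 1 / sqrt (1 - u)"
    using assms by (simp add: powr_minus[of _ "1 / 2"] powr_half_sqrt inverse_eq_divide)
  moreover have "((- 1 / 2) gchoose n) * (- u) ^ n = cbin n * u ^ n" for n
    by (simp add: cbin_eq_gbinomial power_minus[of u])
  ultimately show ?thesis by simp
qed

text \<open>The Wallis product telescopes against the factors \<open>((2k-1)/(2k))\<^sup>2\<close> of the squared ratio.
  This turns its limit \<open>\<pi>/2\<close> into the exact decay rate of \<open>(cbin n)\<^sup>2\<close>, which is the only source of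
  the constant \<open>2/\<pi>\<close> in the recurrence below.\<close>
lemma cbin_square_wallis_product:
  "(2 * real n + 1) * (cbin n)\<^sup>2 * (\<Prod>k=1..n. (4 * real k ^ 2) / (4 * real k ^ 2 - 1)) = 1"
proof (induction n)
  case (Suc n)
  have *: "4 * real (Suc n) ^ 2 - 1 = (2 * real n + 1) * (2 * real n + 3)"
    by (simp add: power2_eq_square algebra_simps)
  have "(2 * real (Suc n) + 1) * (cbin (Suc n))\<^sup>2 * ((4 * real (Suc n) ^ 2) / (4 * real (Suc n) ^ 2 - 1))
     = (2 * real n + 1) * (cbin n)\<^sup>2"
    unfolding * cbin_Suc by (simp add: divide_simps) (simp add: algebra_simps power2_eq_square)
  hence "(2 * real (Suc n) + 1) * (cbin (Suc n))\<^sup>2 * ((4 * real (Suc n) ^ 2) / (4 * real (Suc n) ^ 2 - 1))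
      * (\<Prod>k=1..n. (4 * real k ^ 2) / (4 * real k ^ 2 - 1)) = 1"
    using Suc by (simp only:)
  thus ?case
    by (subst prod.nat_ivl_Suc') (simp, simp only: mult.assoc)
qed simp

lemma cbin_square_asymptotics: "(\<lambda>n. (2 * real n + 1) * (cbin n)\<^sup>2) \<longlonglongrightarrow> 2 / pi"
proof -
  have "(\<lambda>n. inverse (\<Prod>k=1..n. (4 * real k ^ 2) / (4 * real k ^ 2 - 1))) \<longlonglongrightarrow> inverse (pi / 2)"
    by (intro tendsto_inverse wallis) simp
  moreover have "inverse (\<Prod>k=1..n. (4 * real k ^ 2) / (4 * real k ^ 2 - 1)) = (2 * real n + 1) * (cbin n)\<^sup>2" for n
    using cbin_square_wallis_product[of n] by (intro inverse_unique) (simp only: mult_ac)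
  ultimately show ?thesis by simp
qed

lemma cbin_square_le: "(cbin n)\<^sup>2 \<le> 1 / (2 * real n + 1)"
proof -
  have "(2 * real n + 1) * (cbin n)\<^sup>2 \<le> 1"
  proof (induction n)
    case (Suc n)
    have "(2 * real n + 3) * (2 * real n + 1) \<le> (2 * real n + 2)\<^sup>2"
      by (simp add: power2_eq_square algebra_simps)
    hence ratio: "(2 * real n + 3) * (2 * real n + 1) / (2 * real n + 2)\<^sup>2 \<le> 1"
      by (intro divide_le_eq_1_pos[THEN iffD2]) auto
    have "(2 * real (Suc n) + 1) * (cbin (Suc n))\<^sup>2
        = (2 * real n + 1) * (cbin n)\<^sup>2 * ((2 * real n + 3) * (2 * real n + 1) / (2 * real n + 2)\<^sup>2)"
      by (simp add: cbin_Suc power_mult_distrib power_divide power2_eq_square)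
    also have "\<dots> \<le> 1 * 1"
      using Suc ratio by (intro mult_mono) auto
    finally show ?case by simp
  qed simp
  thus ?thesis by (simp add: field_simps)
qed

lemma cbin_le_1: "cbin n \<le> 1"
proof -
  have "(cbin n)\<^sup>2 \<le> 1\<^sup>2" using cbin_square_le[of n] by (rule order_trans) simp
  thus ?thesis by (rule power2_le_imp_le) simp
qed

section \<open>The series as a function of the shift\<close>

definition cbinsum :: "real \<Rightarrow> real" where
  "cbinsum s = (\<Sum>n. (cbin n)\<^sup>2 / (2 * real n + s))"

lemma summable_cbinsum:
  assumes "0 < s"
  shows "summable (\<lambda>n. (cbin n)\<^sup>2 / (2 * real n + s))"
proof (rule summable_comparison_test'[where N = 1])
  show "summable (\<lambda>n. 1 / real n ^ 2)"
    using inverse_power_summable[of 2, where ?'a = real] by (simp add: inverse_eq_divide)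
next
  fix n :: nat assume n: "n \<ge> 1"
  have "(cbin n)\<^sup>2 / (2 * real n + s) \<le> (1 / (2 * real n + 1)) / (2 * real n + s)"
    using assms by (intro divide_right_mono cbin_square_le) simp
  also have "\<dots> = 1 / ((2 * real n + 1) * (2 * real n + s))" by simp
  also have "\<dots> \<le> 1 / real n ^ 2"
    using n assms unfolding power2_eq_square by (intro divide_left_mono mult_mono) auto
  finally show "norm ((cbin n)\<^sup>2 / (2 * real n + s)) \<le> 1 / real n ^ 2"
    using assms by simp
qed

lemma cbinsum_sums:
  "0 < s \<Longrightarrow> (\<lambda>n. (cbin n)\<^sup>2 / (2 * real n + s)) sums cbinsum s"
  unfolding cbinsum_def by (intro summable_sums summable_cbinsum)

text \<open>Division with remainder gives
  \<open>(2n)\<^sup>2 / (2n + s) = 2n - s + s\<^sup>2 / (2n + s)\<close> and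
  \<open>(2n + 1)\<^sup>2 / (2n + s + 2) = 2n - s + (s + 1)\<^sup>2 / (2n + s + 2)\<close>, with the same polynomial part.
  In the difference of the two series the polynomial parts cancel, and \<open>cbin_square_Suc\<close> identifies
  \<open>(2n + 1)\<^sup>2 (cbin n)\<^sup>2\<close> with the next term of the other series. The case \<open>s = 0\<close> is included because
  it yields the starting value at shift 2: there the summand \<open>n = 0\<close> of the second series is a division
  by 0, with value 0, and carries the factor \<open>s\<^sup>2 = 0\<close>.\<close>
lemma cbinsum_telescope:
  assumes "0 \<le> s"
  shows "(\<Sum>n<N. (s + 1)\<^sup>2 * ((cbin n)\<^sup>2 / (2 * real n + (s + 2))) - s\<^sup>2 * ((cbin n)\<^sup>2 / (2 * real n + s)))
     = (2 * real N)\<^sup>2 * (cbin N)\<^sup>2 / (2 * real N + s)"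
proof (induction N)
  case (Suc N)
  have "(s + 1)\<^sup>2 / (2 * real N + (s + 2)) = (2 * real N + 1)\<^sup>2 / (2 * real N + (s + 2)) - (2 * real N - s)"
    using assms by (simp add: divide_simps) (simp add: algebra_simps power2_eq_square)
  moreover have "s\<^sup>2 / (2 * real N + s) = (2 * real N)\<^sup>2 / (2 * real N + s) - (2 * real N - s)"
  proof (cases "2 * real N + s = 0")
    case True thus ?thesis using assms by auto
  next
    case False thus ?thesis by (simp add: divide_simps) (simp add: algebra_simps power2_eq_square)
  qed
  ultimately have "(s + 1)\<^sup>2 / (2 * real N + (s + 2)) * (cbin N)\<^sup>2 - s\<^sup>2 / (2 * real N + s) * (cbin N)\<^sup>2
     = (2 * real N + 1)\<^sup>2 * (cbin N)\<^sup>2 / (2 * real N + (s + 2)) - (2 * real N)\<^sup>2 * (cbin N)\<^sup>2 / (2 * real N + s)"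
    by (simp only: left_diff_distrib times_divide_eq_left)
  also have "(2 * real N + 1)\<^sup>2 * (cbin N)\<^sup>2 = (2 * real (Suc N))\<^sup>2 * (cbin (Suc N))\<^sup>2"
    using cbin_square_Suc[of N] by (simp add: algebra_simps)
  finally show ?case
    unfolding sum.lessThan_Suc Suc by (simp add: algebra_simps)
qed simp

lemma cbinsum_telescope_limit:
  "(\<lambda>N. (2 * real N)\<^sup>2 * (cbin N)\<^sup>2 / (2 * real N + s)) \<longlonglongrightarrow> 2 / pi"
proof -
  have "(\<lambda>N. (2 * real N)\<^sup>2 / ((2 * real N + s) * (2 * real N + 1))) \<longlonglongrightarrow> 1"
    by real_asymp
  from tendsto_mult[OF this cbin_square_asymptotics]
  have "(\<lambda>N. (2 * real N)\<^sup>2 / ((2 * real N + s) * (2 * real N + 1)) * ((2 * real N + 1) * (cbin N)\<^sup>2)) \<longlonglongrightarrow> 2 / pi"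
    by simp
  moreover have "(2 * real N)\<^sup>2 / ((2 * real N + s) * (2 * real N + 1)) * ((2 * real N + 1) * (cbin N)\<^sup>2)
      = (2 * real N)\<^sup>2 * (cbin N)\<^sup>2 / (2 * real N + s)" for N
  proof -
    have "2 * real N + 1 \<noteq> 0" by linarith
    thus ?thesis by simp
  qed
  ultimately show ?thesis by (simp only:)
qed

lemma cbinsum_recurrence:
  assumes "0 < s"
  shows "(s + 1)\<^sup>2 * cbinsum (s + 2) = s\<^sup>2 * cbinsum s + 2 / pi"
proof -
  have "(\<lambda>n. (s + 1)\<^sup>2 * ((cbin n)\<^sup>2 / (2 * real n + (s + 2))) - s\<^sup>2 * ((cbin n)\<^sup>2 / (2 * real n + s)))
      sums ((s + 1)\<^sup>2 * cbinsum (s + 2) - s\<^sup>2 * cbinsum s)"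
    using assms by (intro sums_diff sums_mult cbinsum_sums) auto
  moreover have "(\<lambda>n. (s + 1)\<^sup>2 * ((cbin n)\<^sup>2 / (2 * real n + (s + 2))) - s\<^sup>2 * ((cbin n)\<^sup>2 / (2 * real n + s)))
      sums (2 / pi)"
    unfolding sums_def using assms by (subst cbinsum_telescope) (use cbinsum_telescope_limit in simp_all)
  ultimately show ?thesis using sums_unique2 by fastforce
qed

lemma cbinsum_2: "cbinsum 2 = 2 / pi"
proof -
  have "(\<lambda>n. (0 + 1)\<^sup>2 * ((cbin n)\<^sup>2 / (2 * real n + (0 + 2))) - 0\<^sup>2 * ((cbin n)\<^sup>2 / (2 * real n + 0)))
      sums (2 / pi)"
    unfolding sums_def by (subst cbinsum_telescope) (use cbinsum_telescope_limit[of 0] in simp_all)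
  with cbinsum_sums[of 2] show ?thesis using sums_unique2 by fastforce
qed

text \<open>Multiplied by \<open>(cbin (Suc l))\<^sup>2\<close>, the recurrence becomes a plain summation:
  \<open>(2l+1)\<^sup>2 (cbin l)\<^sup>2 cbinsum (2l+2)\<close> grows by \<open>2/\<pi> (cbin (Suc l))\<^sup>2\<close> in each step.\<close>
lemma cbinsum_even:
  "cbinsum (2 * real l + 2) = 2 / pi * (\<Sum>j=0..l. (cbin j)\<^sup>2) / ((2 * real l + 1)\<^sup>2 * (cbin l)\<^sup>2)"
proof (induction l)
  case 0 show ?case by (simp add: cbinsum_2)
next
  case (Suc l)
  have pos: "cbin l > 0" "cbin (Suc l) > 0" by (rule cbin_pos)+
  define A where "A = (\<Sum>j=0..l. (cbin j)\<^sup>2)"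
  have "(2 * real l + 3)\<^sup>2 * cbinsum (2 * real l + 4) = (2 * real l + 2)\<^sup>2 * cbinsum (2 * real l + 2) + 2 / pi"
    using cbinsum_recurrence[of "2 * real l + 2"] by (simp add: algebra_simps)
  also have "(2 * real l + 2)\<^sup>2 * cbinsum (2 * real l + 2) = 2 / pi * A / (cbin (Suc l))\<^sup>2"
    unfolding Suc A_def[symmetric] cbin_square_Suc[symmetric] using pos by (simp add: add_eq_0_iff)
  finally have "cbinsum (2 * real l + 4) * (2 * real l + 3)\<^sup>2 = 2 / pi * (A + (cbin (Suc l))\<^sup>2) / (cbin (Suc l))\<^sup>2"
    using pos by (simp add: distrib_left add_divide_distrib mult.commute)
  moreover have "(2 * real l + 3)\<^sup>2 \<noteq> 0" by (simp add: add_eq_0_iff)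
  ultimately have "cbinsum (2 * real l + 4)
      = 2 / pi * (A + (cbin (Suc l))\<^sup>2) / (cbin (Suc l))\<^sup>2 / (2 * real l + 3)\<^sup>2"
    by (rule eq_divide_imp[rotated])
  moreover have "(\<Sum>j=0..Suc l. (cbin j)\<^sup>2) = A + (cbin (Suc l))\<^sup>2"
    by (simp add: A_def)
  moreover have "2 * real (Suc l) + 2 = 2 * real l + 4" "2 * real (Suc l) + 1 = 2 * real l + 3"
    by simp_all
  ultimately show ?case
    by (simp only: divide_divide_eq_left mult.commute)
qed

text \<open>Here the quotient \<open>cbinsum (2l+1) / (cbin l)\<^sup>2\<close> is the quantity that the recurrence merely
  increments. Its starting value \<open>cbinsum 1\<close> is out of reach of this
  recurrence and is evaluated through integrals at the end.\<close>
lemma cbinsum_odd: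
  "cbinsum (2 * real l + 1) = (cbin l)\<^sup>2 * (cbinsum 1 + 1 / (2 * pi) * (\<Sum>j=1..l. 1 / ((real j)\<^sup>2 * (cbin j)\<^sup>2)))"
proof (induction l)
  case (Suc l)
  have pos: "cbin l > 0" "cbin (Suc l) > 0" by (rule cbin_pos)+
  define A where "A = (\<Sum>j=1..l. 1 / ((real j)\<^sup>2 * (cbin j)\<^sup>2))"
  have "(2 * real l + 2)\<^sup>2 * cbinsum (2 * real l + 3) = (2 * real l + 1)\<^sup>2 * cbinsum (2 * real l + 1) + 2 / pi"
    using cbinsum_recurrence[of "2 * real l + 1"] by (simp add: algebra_simps)
  also have "\<dots> = (2 * real l + 2)\<^sup>2 * (cbin (Suc l))\<^sup>2 * (cbinsum 1 + 1 / (2 * pi) * A) + 2 / pi"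
    unfolding Suc A_def[symmetric] cbin_square_Suc by simp
  \<comment> \<open>The increment \<open>2/\<pi>\<close> becomes the summand for \<open>j = l + 1\<close>, as \<open>(2l+2)\<^sup>2 = 4 (l+1)\<^sup>2\<close>.\<close>
  also have "2 / pi = (2 * real l + 2)\<^sup>2 * (cbin (Suc l))\<^sup>2 * (1 / (2 * pi) * (1 / ((real (Suc l))\<^sup>2 * (cbin (Suc l))\<^sup>2)))"
    using pos by (simp add: divide_simps) (simp add: power2_eq_square algebra_simps)
  finally have "(2 * real l + 2)\<^sup>2 * cbinsum (2 * real l + 3)
     = (2 * real l + 2)\<^sup>2 * ((cbin (Suc l))\<^sup>2 * (cbinsum 1 + 1 / (2 * pi) * (A + 1 / ((real (Suc l))\<^sup>2 * (cbin (Suc l))\<^sup>2))))"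
    by (simp only: distrib_left distrib_right mult.assoc add.assoc)
  hence "cbinsum (2 * real l + 3) = (cbin (Suc l))\<^sup>2 * (cbinsum 1 + 1 / (2 * pi) * (A + 1 / ((real (Suc l))\<^sup>2 * (cbin (Suc l))\<^sup>2)))"
    by (subst (asm) mult_cancel_left) (simp add: add_eq_0_iff)
  moreover have "2 * real (Suc l) + 1 = 2 * real l + 3" by simp
  moreover have "(\<Sum>j=1..Suc l. 1 / ((real j)\<^sup>2 * (cbin j)\<^sup>2)) = A + 1 / ((real (Suc l))\<^sup>2 * (cbin (Suc l))\<^sup>2)"
    by (simp add: A_def)
  ultimately show ?case by (simp only:)
qed simp

section \<open>Termwise integration\<close>

text \<open>Monotone convergence in the form needed for power series with nonnegative coefficients. The
  exceptional null set \<open>N\<close> absorbs end points at which the series diverges or the limit function takes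
  a default value. Existence of the integral of \<open>g\<close> is part of the conclusion, so that unbounded
  integrands need no separate treatment.\<close>
lemma has_integral_sums_nonneg:
  fixes f :: "nat \<Rightarrow> 'a::euclidean_space \<Rightarrow> real"
  assumes f: "\<And>n. (f n has_integral c n) S"
    and nonneg: "\<And>n x. x \<in> S \<Longrightarrow> 0 \<le> f n x"
    and sums: "\<And>x. x \<in> S - N \<Longrightarrow> (\<lambda>n. f n x) sums g x"
    and N: "negligible N"
    and c: "c sums C"
  shows "(g has_integral C) S"
proof -
  define h where "h n x = (if x \<in> N then 0 else f n x)" for n x
  have h: "(h n has_integral c n) S" for n
    by (rule has_integral_spike[OF N _ f]) (simp add: h_def)
  \<comment> \<open>Setting everything to 0 on \<open>N\<close> gives monotone convergence at every point of \<open>S\<close>.\<close>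
  have "((\<lambda>x. if x \<in> N then 0 else g x) has_integral C) S"
  proof (rule has_integral_monotone_convergence_increasing)
    show "((\<lambda>x. \<Sum>n<k. h n x) has_integral (\<Sum>n<k. c n)) S" for k
      by (intro has_integral_sum h) auto
    show "(\<Sum>n<k. h n x) \<le> (\<Sum>n<Suc k. h n x)" if "x \<in> S" for k x
      using nonneg[OF that, of k] by (simp add: h_def)
    show "(\<lambda>k. \<Sum>n<k. h n x) \<longlonglongrightarrow> (if x \<in> N then 0 else g x)" if "x \<in> S" for x
      using sums[of x] that by (auto simp: h_def sums_def)
    show "(\<lambda>k. \<Sum>n<k. c n) \<longlonglongrightarrow> C"
      using c by (simp add: sums_def)
  qed
  thus ?thesis
    by (rule has_integral_spike[OF N, rotated]) simp
qed

text \<open>Wallis' reduction formula: the derivative of \<open>- cos \<theta> sin\<^sup>2\<^sup>n\<^sup>+\<^sup>1 \<theta>\<close> is a combination of two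
  consecutive even powers of the sine, and this function vanishes at both end points.\<close>
lemma has_integral_sin_even_power:
  "((\<lambda>\<theta>. sin \<theta> ^ (2 * n)) has_integral (pi / 2 * cbin n)) {0..pi / 2}"
proof (induction n)
  case 0
  show ?case using has_integral_const_real[of "1::real" 0 "pi / 2"] by simp
next
  case (Suc n)
  have "((\<lambda>\<theta>. (2 * real n + 2) * sin \<theta> ^ (2 * n + 2) - (2 * real n + 1) * sin \<theta> ^ (2 * n))
      has_integral (- cos (pi / 2) * sin (pi / 2) ^ (2 * n + 1) - (- cos 0 * sin 0 ^ (2 * n + 1)))) {0..pi / 2}"
  proof (rule fundamental_theorem_of_calculus)
    fix \<theta> :: real
    have cs: "cos \<theta> * cos \<theta> = 1 - sin \<theta> * sin \<theta>"
      using sin_cos_squared_add3[of \<theta>] by linarith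
    have "((\<lambda>\<theta>. - cos \<theta> * sin \<theta> ^ Suc (2 * n)) has_real_derivative
        - cos \<theta> * (real (Suc (2 * n)) * (cos \<theta> * sin \<theta> ^ (Suc (2 * n) - Suc 0)))
          + sin \<theta> * sin \<theta> ^ Suc (2 * n)) (at \<theta> within {0..pi / 2})"
      by (rule derivative_eq_intros refl)+ (simp only: minus_mult_left minus_minus mult_1_right mult_ac add_ac)
    hence "((\<lambda>\<theta>. - cos \<theta> * sin \<theta> ^ (2 * n + 1)) has_real_derivative
        sin \<theta> * sin \<theta> ^ (2 * n + 1) - (2 * real n + 1) * (sin \<theta> ^ (2 * n) * (cos \<theta> * cos \<theta>))) (at \<theta> within {0..pi / 2})"
      by (simp add: algebra_simps)
    also have "sin \<theta> * sin \<theta> ^ (2 * n + 1) - (2 * real n + 1) * (sin \<theta> ^ (2 * n) * (cos \<theta> * cos \<theta>))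
       = (2 * real n + 2) * sin \<theta> ^ (2 * n + 2) - (2 * real n + 1) * sin \<theta> ^ (2 * n)"
      unfolding cs by (simp add: algebra_simps)
    finally show "((\<lambda>\<theta>. - cos \<theta> * sin \<theta> ^ (2 * n + 1)) has_vector_derivative
        (2 * real n + 2) * sin \<theta> ^ (2 * n + 2) - (2 * real n + 1) * sin \<theta> ^ (2 * n)) (at \<theta> within {0..pi / 2})"
      by (simp add: has_real_derivative_iff_has_vector_derivative)
  qed simp
  from has_integral_add[OF this has_integral_mult_right[OF Suc, of "2 * real n + 1"]]
  have "((\<lambda>\<theta>. (2 * real n + 2) * sin \<theta> ^ (2 * n + 2)) has_integral ((2 * real n + 1) * (pi / 2 * cbin n))) {0..pi / 2}"
    by simp
  from has_integral_mult_right[OF this, of "1 / (2 * real n + 2)"]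
  show ?case
    by (simp add: cbin_Suc mult_ac)
qed

section \<open>Moments of the elliptic integral\<close>

text \<open>The integrand is expanded by the binomial series in \<open>x\<^sup>2 sin\<^sup>2 \<theta>\<close>. One factor \<open>cbin n\<close> comes from
  the binomial coefficient and the other from the integral of \<open>sin\<^sup>2\<^sup>n\<close>.\<close>
lemma ellipticK_power_series:
  assumes "\<bar>x\<bar> < 1"
  shows "(\<lambda>n. pi / 2 * (cbin n)\<^sup>2 * x ^ (2 * n)) sums ellipticK x"
proof -
  have x2: "x\<^sup>2 < 1" using assms by (simp add: abs_square_less_1)
  have "summable (\<lambda>n. pi / 2 * (cbin n)\<^sup>2 * x ^ (2 * n))"
  proof (rule summable_comparison_test'[where N = 0])
    show "summable (\<lambda>n. pi / 2 * (x\<^sup>2) ^ n)"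
      using x2 by (intro summable_mult summable_geometric) simp
    fix n :: nat
    have "pi / 2 * (cbin n)\<^sup>2 * (x\<^sup>2) ^ n \<le> pi / 2 * 1 * (x\<^sup>2) ^ n"
      using cbin_le_1[of n] cbin_nonneg[of n]
      by (intro mult_right_mono mult_left_mono) (auto simp: power_le_one)
    thus "norm (pi / 2 * (cbin n)\<^sup>2 * x ^ (2 * n)) \<le> pi / 2 * (x\<^sup>2) ^ n"
      by (simp add: power_mult)
  qed
  then obtain C where C: "(\<lambda>n. pi / 2 * (cbin n)\<^sup>2 * x ^ (2 * n)) sums C"
    unfolding summable_def by blast
  have "((\<lambda>\<theta>. 1 / sqrt (1 - x\<^sup>2 * (sin \<theta>)\<^sup>2)) has_integral C) {0..pi / 2}"
  proof (rule has_integral_sums_nonneg[where N = "{}", OF _ _ _ _ C])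
    fix n
    show "((\<lambda>\<theta>. cbin n * x ^ (2 * n) * sin \<theta> ^ (2 * n)) has_integral pi / 2 * (cbin n)\<^sup>2 * x ^ (2 * n)) {0..pi / 2}"
      using has_integral_mult_right[OF has_integral_sin_even_power[of n], of "cbin n * x ^ (2 * n)"]
      by (simp add: power2_eq_square mult_ac)
  next
    fix n \<theta>
    show "0 \<le> cbin n * x ^ (2 * n) * sin \<theta> ^ (2 * n)"
      by (intro mult_nonneg_nonneg cbin_nonneg zero_le_even_power) auto
  next
    fix \<theta> :: real
    have "x\<^sup>2 * (sin \<theta>)\<^sup>2 \<le> x\<^sup>2 * 1"
      by (intro mult_left_mono) (auto simp: abs_square_le_1)
    hence "\<bar>x\<^sup>2 * (sin \<theta>)\<^sup>2\<bar> < 1" using x2 by simp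
    from cbin_power_series[OF this]
    show "(\<lambda>n. cbin n * x ^ (2 * n) * sin \<theta> ^ (2 * n)) sums (1 / sqrt (1 - x\<^sup>2 * (sin \<theta>)\<^sup>2))"
      by (simp only: power_mult_distrib power_mult mult.assoc)
  qed simp
  hence "ellipticK x = C"
    unfolding ellipticK_def by (rule integral_unique)
  with C show ?thesis by simp
qed

lemma has_integral_real_power:
  "((\<lambda>x::real. x ^ k) has_integral b ^ Suc k / real (Suc k)) {0..b}" if "0 \<le> b"
proof -
  have "((\<lambda>x::real. x ^ k) has_integral (b ^ Suc k / real (Suc k) - 0 ^ Suc k / real (Suc k))) {0..b}"
    by (rule fundamental_theorem_of_calculus[OF that])
       (auto intro!: derivative_eq_intros simp flip: has_real_derivative_iff_has_vector_derivative
             simp del: power_Suc of_nat_Suc)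
  thus ?thesis by simp
qed

text \<open>Integrability of the logarithmically singular \<open>K\<close> comes for free from the convergence of the
  integrated series. The point \<open>x = 1\<close> is exceptional, since the power series of \<open>K\<close> diverges
  there.\<close>
lemma has_integral_ellipticK_moment:
  "((\<lambda>x. x ^ m * ellipticK x) has_integral (pi / 2 * cbinsum (real m + 1))) {0..1}"
proof (rule has_integral_sums_nonneg[where N = "{1}"])
  show "(\<lambda>n. pi / 2 * ((cbin n)\<^sup>2 / (2 * real n + (real m + 1)))) sums (pi / 2 * cbinsum (real m + 1))"
    by (intro sums_mult cbinsum_sums) simp
next
  fix n
  show "((\<lambda>x. pi / 2 * (cbin n)\<^sup>2 * x ^ (2 * n + m)) has_integral
      pi / 2 * ((cbin n)\<^sup>2 / (2 * real n + (real m + 1)))) {0..1}"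
    using has_integral_mult_right[OF has_integral_real_power[of 1 "2 * n + m"], of "pi / 2 * (cbin n)\<^sup>2"]
    by (simp add: add_ac)
next
  fix x :: real assume "x \<in> {0..1} - {1}"
  hence "\<bar>x\<bar> < 1" by auto
  from sums_mult[OF ellipticK_power_series[OF this], of "x ^ m"]
  show "(\<lambda>n. pi / 2 * (cbin n)\<^sup>2 * x ^ (2 * n + m)) sums (x ^ m * ellipticK x)"
    by (simp add: power_add mult_ac)
qed simp_all

section \<open>Catalan's constant\<close>

text \<open>Both sides integrate the binomial series of \<open>1 / sqrt (1 - u\<^sup>2)\<close> over \<open>[0, y]\<close>: the left side
  termwise, the right side by the fundamental theorem of calculus.\<close>
lemma arcsin_power_series:
  assumes "0 \<le> y" "y < 1"
  shows "(\<lambda>n. cbin n * y ^ (2 * n + 1) / (2 * real n + 1)) sums arcsin y"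
proof -
  have y2: "y\<^sup>2 < 1" using assms by (simp add: abs_square_less_1)
  have "summable (\<lambda>n. cbin n * y ^ (2 * n + 1) / (2 * real n + 1))"
  proof (rule summable_comparison_test'[where N = 0])
    show "summable (\<lambda>n. (y\<^sup>2) ^ n)"
      using y2 by (intro summable_geometric) simp
    fix n :: nat
    have "cbin n * y ^ (2 * n + 1) / (2 * real n + 1) \<le> cbin n * y ^ (2 * n + 1) / 1"
      using assms cbin_nonneg[of n] by (intro divide_left_mono) auto
    also have "\<dots> \<le> 1 * y ^ (2 * n)"
      using assms cbin_nonneg[of n] unfolding div_by_1
      by (intro mult_mono cbin_le_1 power_decreasing) auto
    finally show "norm (cbin n * y ^ (2 * n + 1) / (2 * real n + 1)) \<le> (y\<^sup>2) ^ n"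
      using assms cbin_nonneg[of n] by (simp add: power_mult)
  qed
  then obtain C where C: "(\<lambda>n. cbin n * y ^ (2 * n + 1) / (2 * real n + 1)) sums C"
    unfolding summable_def by blast
  have "((\<lambda>u. 1 / sqrt (1 - u\<^sup>2)) has_integral C) {0..y}"
  proof (rule has_integral_sums_nonneg[where N = "{}", OF _ _ _ _ C])
    fix n
    show "((\<lambda>u. cbin n * u ^ (2 * n)) has_integral cbin n * y ^ (2 * n + 1) / (2 * real n + 1)) {0..y}"
      using has_integral_mult_right[OF has_integral_real_power[OF assms(1), of "2 * n"], of "cbin n"]
      by (simp add: add_ac)
  next
    fix u assume "u \<in> {0..y} - {}"
    hence "\<bar>u\<^sup>2\<bar> < 1" using assms by (auto simp: abs_square_less_1)
    from cbin_power_series[OF this]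
    show "(\<lambda>n. cbin n * u ^ (2 * n)) sums (1 / sqrt (1 - u\<^sup>2))"
      by (simp add: power_mult)
  qed (auto simp: cbin_nonneg)
  moreover have "((\<lambda>u. 1 / sqrt (1 - u\<^sup>2)) has_integral (arcsin y - arcsin 0)) {0..y}"
  proof (rule fundamental_theorem_of_calculus[OF assms(1)])
    fix u assume "u \<in> {0..y}"
    hence "(arcsin has_real_derivative inverse (sqrt (1 - u\<^sup>2))) (at u)"
      using assms by (intro DERIV_arcsin) auto
    from has_field_derivative_at_within[OF this]
    show "(arcsin has_vector_derivative 1 / sqrt (1 - u\<^sup>2)) (at u within {0..y})"
      by (simp add: has_real_derivative_iff_has_vector_derivative inverse_eq_divide)
  qed
  ultimately have "C = arcsin y - arcsin 0"
    by (rule has_integral_unique)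
  with C show ?thesis by simp
qed

text \<open>For \<open>0 < \<theta> < \<pi>/2\<close>, the arcsine series at \<open>y = sin \<theta>\<close>, divided by \<open>sin \<theta>\<close>, expands
  \<open>\<theta> / sin \<theta>\<close> in even powers of the sine. The end points are excluded because the integrand
  has the default value 0 at 0, and because the arcsine series is only established for
  \<open>y < 1\<close>.\<close>
lemma has_integral_theta_over_sin_cbinsum:
  "((\<lambda>\<theta>. \<theta> / sin \<theta>) has_integral (pi / 2 * cbinsum 1)) {0..pi / 2}"
proof (rule has_integral_sums_nonneg[where N = "{0, pi / 2}"])
  show "(\<lambda>n. pi / 2 * ((cbin n)\<^sup>2 / (2 * real n + 1))) sums (pi / 2 * cbinsum 1)"
    by (intro sums_mult cbinsum_sums) simp
next
  fix n
  show "((\<lambda>\<theta>. cbin n / (2 * real n + 1) * sin \<theta> ^ (2 * n)) has_integral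
      pi / 2 * ((cbin n)\<^sup>2 / (2 * real n + 1))) {0..pi / 2}"
    using has_integral_mult_right[OF has_integral_sin_even_power[of n], of "cbin n / (2 * real n + 1)"]
    by (simp add: power2_eq_square mult_ac)
next
  fix n \<theta>
  show "0 \<le> cbin n / (2 * real n + 1) * sin \<theta> ^ (2 * n)"
    by (intro mult_nonneg_nonneg divide_nonneg_nonneg cbin_nonneg zero_le_even_power) auto
next
  fix \<theta> :: real assume "\<theta> \<in> {0..pi / 2} - {0, pi / 2}"
  hence \<theta>: "0 < \<theta>" "\<theta> < pi / 2" by auto
  have s0: "0 < sin \<theta>" using \<theta> by (intro sin_gt_zero) auto
  have s1: "sin \<theta> < 1"
    using sin_monotone_2pi[of \<theta> "pi / 2"] \<theta> by simp
  have "arcsin (sin \<theta>) = \<theta>" using \<theta> by (intro arcsin_sin) auto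
  with sums_divide[OF arcsin_power_series[of "sin \<theta>"], of "sin \<theta>"] s0 s1
  have "(\<lambda>n. cbin n * sin \<theta> ^ (2 * n + 1) / (2 * real n + 1) / sin \<theta>) sums (\<theta> / sin \<theta>)"
    by simp
  thus "(\<lambda>n. cbin n / (2 * real n + 1) * sin \<theta> ^ (2 * n)) sums (\<theta> / sin \<theta>)"
    using s0 by simp
qed simp

text \<open>The power series of \<open>Ti\<^sub>2\<close>, the primitive of \<open>arctan t / t\<close> that vanishes at 0; its value
  at 1 is Catalan's constant by definition.\<close>
definition inverse_tangent_integral :: "real \<Rightarrow> real" where
  "inverse_tangent_integral t = (\<Sum>j. (- 1) ^ j * t ^ (2 * j + 1) / (2 * real j + 1)\<^sup>2)"

lemma inverse_tangent_integral_0: "inverse_tangent_integral 0 = 0"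
  by (simp add: inverse_tangent_integral_def)

lemma inverse_tangent_integral_1: "inverse_tangent_integral 1 = catalan_G"
  by (simp add: inverse_tangent_integral_def catalan_G_def)

text \<open>The coefficients are absolutely summable, so the series converges uniformly up to the end
  point 1. This continuity carries the evaluation at \<open>t = 1\<close>, where the differentiated series
  no longer converges absolutely.\<close>
lemma continuous_on_inverse_tangent_integral: "continuous_on {0..1} inverse_tangent_integral"
proof -
  have "summable (\<lambda>j. 1 / real (Suc j) ^ 2)"
    by (subst summable_Suc_iff) (use inverse_power_summable[of 2, where ?'a = real] in \<open>simp add: inverse_eq_divide\<close>)
  moreover have "norm ((- 1) ^ j * t ^ (2 * j + 1) / (2 * real j + 1)\<^sup>2) \<le> 1 / real (Suc j) ^ 2"
    if "t \<in> {0..1}" for j and t :: real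
  proof -
    have "\<bar>t\<bar> ^ (2 * j + 1) / (2 * real j + 1)\<^sup>2 \<le> 1 / real (Suc j) ^ 2"
      using that by (intro frac_le power_le_one power_mono) auto
    thus ?thesis by (simp add: abs_mult power_abs)
  qed
  ultimately have "uniform_limit {0..1} (\<lambda>n t. \<Sum>j<n. (- 1) ^ j * t ^ (2 * j + 1) / (2 * real j + 1)\<^sup>2)
      inverse_tangent_integral sequentially"
    unfolding inverse_tangent_integral_def[abs_def] by (intro Weierstrass_m_test)
  thus ?thesis
    by (rule uniform_limit_theorem[rotated]) (auto intro!: always_eventually continuous_intros)
qed

lemma has_real_derivative_inverse_tangent_integral:
  assumes "0 < t" "t < 1"
  shows "(inverse_tangent_integral has_real_derivative arctan t / t) (at t)"
proof -
  \<comment> \<open>A radius strictly between \<open>t\<close> and 1, so that a geometric series dominates the derivatives.\<close>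
  define r where "r = (t + 1) / 2"
  have r: "t < r" "r < 1" "0 < r" using assms by (auto simp: r_def)
  have "((\<lambda>t. \<Sum>j. (- 1) ^ j * t ^ (2 * j + 1) / (2 * real j + 1)\<^sup>2) has_real_derivative
      (\<Sum>j. (- 1) ^ j * t ^ (2 * j) / (2 * real j + 1))) (at t)"
  proof (rule has_field_derivative_series'(2)[of "{0..r}"
      "\<lambda>j t. (- 1) ^ j * t ^ (2 * j + 1) / (2 * real j + 1)\<^sup>2"
      "\<lambda>j t. (- 1) ^ j * t ^ (2 * j) / (2 * real j + 1)" 0 t])
    fix j :: nat and x :: real
    have "((\<lambda>x. (- 1) ^ j * x ^ (2 * j + 1) / (2 * real j + 1)\<^sup>2) has_real_derivative
        (- 1) ^ j * ((2 * real j + 1) * x ^ (2 * j)) / (2 * real j + 1)\<^sup>2) (at x within {0..r})"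
      using DERIV_cdivide[OF DERIV_cmult[OF DERIV_pow[of "2 * j + 1" x "{0..r}"], of "(- 1) ^ j"],
          of "(2 * real j + 1)\<^sup>2"] by (simp add: add_ac)
    thus "((\<lambda>x. (- 1) ^ j * x ^ (2 * j + 1) / (2 * real j + 1)\<^sup>2) has_real_derivative
        (- 1) ^ j * x ^ (2 * j) / (2 * real j + 1)) (at x within {0..r})"
      by (simp add: power2_eq_square)
  next
    have "summable (\<lambda>j. (r\<^sup>2) ^ j)"
      using r by (intro summable_geometric) (simp add: abs_square_less_1)
    moreover have "norm ((- 1) ^ j * x ^ (2 * j) / (2 * real j + 1)) \<le> (r\<^sup>2) ^ j"
      if "x \<in> {0..r}" for x j
    proof -
      have "x ^ (2 * j) / (2 * real j + 1) \<le> x ^ (2 * j) / 1"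
        using that by (intro divide_left_mono) auto
      also have "\<dots> \<le> (r\<^sup>2) ^ j"
        using that by (simp add: power_mono flip: power_mult)
      finally show ?thesis using that by (simp add: abs_mult power_abs)
    qed
    ultimately show "uniformly_convergent_on {0..r} (\<lambda>n x. \<Sum>j<n. (- 1) ^ j * x ^ (2 * j) / (2 * real j + 1))"
      by (intro Weierstrass_m_test')
  qed (use r assms in auto)
  moreover have "(\<Sum>j. (- 1) ^ j * t ^ (2 * j) / (2 * real j + 1)) = arctan t / t"
  proof -
    have "(\<lambda>k. (- 1) ^ k * (1 / real (k * 2 + 1) * t ^ (k * 2 + 1))) sums arctan t"
      using summable_sums[OF summable_arctan_series[of t]] arctan_series[of t] assms by simp
    from sums_divide[OF this, of t]
    have "(\<lambda>k. (- 1) ^ k * t ^ (2 * k) / (2 * real k + 1)) sums (arctan t / t)"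
      using assms by (simp add: mult_ac add_ac)
    thus ?thesis by (simp add: sums_iff)
  qed
  ultimately show ?thesis
    by (simp add: inverse_tangent_integral_def[abs_def])
qed

text \<open>The half-angle substitution \<open>t = tan (\<theta>/2)\<close> turns \<open>\<theta> / sin \<theta> d\<theta>\<close> into
  \<open>2 arctan t / t dt\<close>. Hence \<open>2 Ti\<^sub>2 (tan (\<theta>/2))\<close> is a primitive on the open interval, and its
  values at 0 and \<open>\<pi>/2\<close> are 0 and \<open>2 G\<close>.\<close>
lemma has_integral_theta_over_sin_catalan:
  "((\<lambda>\<theta>. \<theta> / sin \<theta>) has_integral (2 * catalan_G)) {0..pi / 2}"
proof -
  have tan_le: "tan (\<theta> / 2) \<le> 1" if "0 \<le> \<theta>" "\<theta> \<le> pi / 2" for \<theta> :: real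
    using tan_mono_le[of "\<theta> / 2" "pi / 4"] that by (simp add: tan_45)
  have tan_ge: "0 \<le> tan (\<theta> / 2)" if "0 \<le> \<theta>" "\<theta> \<le> pi / 2" for \<theta> :: real
  proof -
    have "\<theta> / 2 < pi / 2" using that pi_gt_zero by linarith
    thus ?thesis using tan_mono_le[of 0 "\<theta> / 2"] that by simp
  qed
  have cos_pos: "0 < cos (\<theta> / 2)" if "0 \<le> \<theta>" "\<theta> \<le> pi / 2" for \<theta> :: real
    using that pi_gt_zero by (intro cos_gt_zero_pi) linarith+
  have "((\<lambda>\<theta>. \<theta> / sin \<theta>) has_integral
      (2 * inverse_tangent_integral (tan (pi / 2 / 2)) - 2 * inverse_tangent_integral (tan (0 / 2)))) {0..pi / 2}"
  proof (rule fundamental_theorem_of_calculus_interior)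
    have "continuous_on {0..pi / 2} (\<lambda>\<theta>. tan (\<theta> / 2))"
      using cos_pos by (intro continuous_intros) force+
    hence "continuous_on {0..pi / 2} (\<lambda>\<theta>. inverse_tangent_integral (tan (\<theta> / 2)))"
      by (rule continuous_on_compose2[OF continuous_on_inverse_tangent_integral]) (use tan_le tan_ge in force)
    thus "continuous_on {0..pi / 2} (\<lambda>\<theta>. 2 * inverse_tangent_integral (tan (\<theta> / 2)))"
      by (intro continuous_intros)
  next
    fix \<theta> :: real assume "\<theta> \<in> {0<..<pi / 2}"
    hence \<theta>: "0 < \<theta>" "\<theta> < pi / 2" by auto
    have t: "0 < tan (\<theta> / 2)" "tan (\<theta> / 2) < 1"
      using \<theta> tan_monotone[of 0 "\<theta> / 2"] tan_monotone[of "\<theta> / 2" "pi / 4"] by (simp_all add: tan_45)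
    have c: "0 < cos (\<theta> / 2)" using \<theta> by (intro cos_pos) auto
    have s: "0 < sin (\<theta> / 2)" using \<theta> by (intro sin_gt_zero) auto
    have at: "arctan (tan (\<theta> / 2)) = \<theta> / 2" using \<theta> by (intro arctan_tan) auto
    have "((\<lambda>\<theta>. tan (\<theta> / 2)) has_real_derivative inverse ((cos (\<theta> / 2))\<^sup>2) * (1 / 2)) (at \<theta>)"
      by (rule DERIV_chain'[where f = "\<lambda>\<theta>. \<theta> / 2", OF _ DERIV_tan]) (use c in \<open>auto intro!: derivative_eq_intros\<close>)
    from DERIV_chain'[OF this has_real_derivative_inverse_tangent_integral[OF t]]
    have "((\<lambda>\<theta>. 2 * inverse_tangent_integral (tan (\<theta> / 2))) has_real_derivative
        2 * (\<theta> / 2 / tan (\<theta> / 2) * (inverse ((cos (\<theta> / 2))\<^sup>2) * (1 / 2)))) (at \<theta>)"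
      unfolding at by (rule DERIV_cmult)
    also have "2 * (\<theta> / 2 / tan (\<theta> / 2) * (inverse ((cos (\<theta> / 2))\<^sup>2) * (1 / 2)))
        = \<theta> / (2 * sin (\<theta> / 2) * cos (\<theta> / 2))"
      using c s by (simp add: tan_def power2_eq_square field_simps)
    also have "2 * sin (\<theta> / 2) * cos (\<theta> / 2) = sin \<theta>"
      using sin_double[of "\<theta> / 2"] by simp
    finally show "((\<lambda>\<theta>. 2 * inverse_tangent_integral (tan (\<theta> / 2))) has_vector_derivative \<theta> / sin \<theta>) (at \<theta>)"
      by (simp add: has_real_derivative_iff_has_vector_derivative)
  qed simp
  thus ?thesis by (simp add: inverse_tangent_integral_0 inverse_tangent_integral_1 tan_45)
qed

lemma cbinsum_1: "cbinsum 1 = 4 * catalan_G / pi"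
  using has_integral_unique[OF has_integral_theta_over_sin_cbinsum has_integral_theta_over_sin_catalan]
  by (simp add: field_simps)

section \<open>Evaluation of the moments\<close>

theorem theorem3p4:
  fixes m :: nat
  shows "(\<lambda>x. x ^ m * ellipticK x) integrable_on {0..1}
    \<and> (\<lambda>n. 1 / 16 ^ n * (real ((2 * n) choose n))\<^sup>2 * (1 / (2 * real n + real m + 1)))
        sums (2 / pi * integral {0..1} (\<lambda>x. x ^ m * ellipticK x))
    \<and> (\<forall>l::nat. m = 2 * l + 1 \<longrightarrow>
         2 / pi * integral {0..1} (\<lambda>x. x ^ m * ellipticK x)
         = 1 / pi * (2 * 16 ^ l / ((2 * real l + 1)\<^sup>2 * (real ((2 * l) choose l))\<^sup>2)
             * (\<Sum>j=0..l. (real ((2 * j) choose j))\<^sup>2 / 16 ^ j)))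
    \<and> (\<forall>l::nat. m = 2 * l \<longrightarrow>
         2 / pi * integral {0..1} (\<lambda>x. x ^ m * ellipticK x)
         = 1 / pi * ((real ((2 * l) choose l))\<^sup>2 / 16 ^ l
             * (4 * catalan_G
                + 1 / 2 * (\<Sum>j=1..l. 16 ^ j / ((real j)\<^sup>2 * (real ((2 * j) choose j))\<^sup>2)))))"
proof (intro conjI allI impI)
  show "(\<lambda>x. x ^ m * ellipticK x) integrable_on {0..1}"
    using has_integral_ellipticK_moment by (rule has_integral_integrable)
  have moment: "2 / pi * integral {0..1} (\<lambda>x. x ^ m * ellipticK x) = cbinsum (real m + 1)"
    by (simp add: integral_unique[OF has_integral_ellipticK_moment])
  show "(\<lambda>n. 1 / 16 ^ n * (real ((2 * n) choose n))\<^sup>2 * (1 / (2 * real n + real m + 1)))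
      sums (2 / pi * integral {0..1} (\<lambda>x. x ^ m * ellipticK x))"
    unfolding moment using cbinsum_sums[of "real m + 1"] by (simp add: cbin_square add_ac)
  fix l :: nat
  show "2 / pi * integral {0..1} (\<lambda>x. x ^ m * ellipticK x)
         = 1 / pi * (2 * 16 ^ l / ((2 * real l + 1)\<^sup>2 * (real ((2 * l) choose l))\<^sup>2)
             * (\<Sum>j=0..l. (real ((2 * j) choose j))\<^sup>2 / 16 ^ j))" if "m = 2 * l + 1"
  proof -
    have m: "real m + 1 = 2 * real l + 2" using that by simp
    show ?thesis
      unfolding moment m cbinsum_even cbin_square by simp
  qed
  show "2 / pi * integral {0..1} (\<lambda>x. x ^ m * ellipticK x)
         = 1 / pi * ((real ((2 * l) choose l))\<^sup>2 / 16 ^ l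
             * (4 * catalan_G
                + 1 / 2 * (\<Sum>j=1..l. 16 ^ j / ((real j)\<^sup>2 * (real ((2 * j) choose j))\<^sup>2))))" if "m = 2 * l"
  proof -
    have m: "real m + 1 = 2 * real l + 1" using that by simp
    show ?thesis
      unfolding moment m cbinsum_odd cbinsum_1 cbin_square by (simp add: distrib_left mult_ac)
  qed
qed

end
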